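(* Let $N\ge 1$ be an integer and $0<p<1$. Consider a particle on $\{0,1,\dots,N\}$ which, when at a position $x$ with $0<x<N$, moves to $x-1$ with probability $\frac{1-p}{2}$, to $x+1$ with probability $\frac{1-p}{2}$, or to $N-x$ with probability $p$, and which stops upon reaching $0$ or $N$. Let $g(x)$ be the expected number of steps until the particle started at $x$ reaches $0$ or $N$, i.e. the solution of \[ g(x)=\frac{1-p}{2}g(x-1)+\frac{1-p}{2}g(x+1)+p\,g(N-x)+1\quad (0<x<N),\qquad g(0)=g(N)=0. \] Then for $0\le x\le N$, \[ g(x)=\frac{1}{1-p}\,x(N-x). \]
   Context: The move from $x$ to $N-x$ is called the mirror step; this is the symmetric case where left and right unit steps have equal probability $\frac{1-p}{2}$. *)

theory Defs
  imports "HOL-Probability.Probability"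
begin

text \<open>
  One-step transition probabilities. The three contributions are added, so that coinciding
  targets (such as \<open>N - x = x + 1\<close>) accumulate their probabilities; for \<open>N - x = x\<close> the
  mirror step leaves the position unchanged but still counts as a step.
\<close>

definition mirror_kernel :: "nat \<Rightarrow> real \<Rightarrow> nat \<Rightarrow> nat \<Rightarrow> real" where
  "mirror_kernel N p x y =
     (if 0 < x \<and> x < N
      then (1 - p) / 2 * of_bool (y = x - 1) + (1 - p) / 2 * of_bool (y = x + 1)
           + p * of_bool (y = N - x)
      else of_bool (y = x))"

text \<open>
  \<open>X\<close> is a Markov chain with the above transition probabilities, started at \<open>x\<close>. The transition
  law is stated in product form, so conditioning on null events does not arise.
\<close>

definition mirror_walk ::
    "'a measure \<Rightarrow> nat \<Rightarrow> real \<Rightarrow> nat \<Rightarrow> (nat \<Rightarrow> 'a \<Rightarrow> nat) \<Rightarrow> bool" where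
  "mirror_walk M N p x X \<longleftrightarrow>
     prob_space M \<and>
     (\<forall>n. X n \<in> measurable M (count_space UNIV)) \<and>
     (AE \<omega> in M. X 0 \<omega> = x) \<and>
     (\<forall>n xs y. \<P>(\<omega> in M. (\<forall>i\<le>n. X i \<omega> = xs i) \<and> X (Suc n) \<omega> = y)
             = \<P>(\<omega> in M. \<forall>i\<le>n. X i \<omega> = xs i) * mirror_kernel N p (xs n) y)"

text \<open>The infimum is \<open>\<infinity>\<close> if neither \<open>0\<close> nor \<open>N\<close> is ever reached.\<close>

definition steps_to_boundary :: "nat \<Rightarrow> (nat \<Rightarrow> 'a \<Rightarrow> nat) \<Rightarrow> 'a \<Rightarrow> enat" where
  "steps_to_boundary N X \<omega> = (INF n\<in>{n. X n \<omega> = 0 \<or> X n \<omega> = N}. enat n)"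

definition expected_steps :: "'a measure \<Rightarrow> nat \<Rightarrow> (nat \<Rightarrow> 'a \<Rightarrow> nat) \<Rightarrow> ennreal" where
  "expected_steps M N X = (\<integral>\<^sup>+\<omega>. ennreal_of_enat (steps_to_boundary N X \<omega>) \<partial>M)"

definition mirror_equations :: "nat \<Rightarrow> real \<Rightarrow> (nat \<Rightarrow> real) \<Rightarrow> bool" where
  "mirror_equations N p g \<longleftrightarrow>
     (\<forall>x. 0 < x \<and> x < N \<longrightarrow>
        g x = (1 - p) / 2 * g (x - 1) + (1 - p) / 2 * g (x + 1) + p * g (N - x) + 1) \<and>
     g 0 = 0 \<and> g N = 0"

text \<open>
  Such chains exist: drive the particle by independent pairs of coin flips, the first deciding
  whether to mirror and the second choosing the direction of a unit step.
\<close>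

definition mirror_move :: "nat \<Rightarrow> nat \<Rightarrow> bool \<times> bool \<Rightarrow> nat" where
  "mirror_move N x t =
     (if 0 < x \<and> x < N then (if fst t then N - x else if snd t then x - 1 else x + 1) else x)"

primrec coin_walk :: "nat \<Rightarrow> nat \<Rightarrow> nat \<Rightarrow> (bool \<times> bool) stream \<Rightarrow> nat" where
  "coin_walk N 0 x s = x"
| "coin_walk N (Suc n) x s = coin_walk N n (mirror_move N x (shd s)) (stl s)"

definition coin_measure :: "real \<Rightarrow> (bool \<times> bool) measure" where
  "coin_measure p = measure_pmf (pair_pmf (bernoulli_pmf p) (bernoulli_pmf (1 / 2)))"

lemma measurable_coin_walk [measurable]:
  "coin_walk N n x \<in> measurable (stream_space (coin_measure p)) (count_space UNIV)"
proof (induction n arbitrary: x)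
  case 0
  then show ?case by simp
next
  case (Suc n)
  have [measurable]: "(\<lambda>s. coin_walk N n y (stl s))
      \<in> measurable (stream_space (coin_measure p)) (count_space UNIV)" for y
    using measurable_compose[OF measurable_stl Suc[of y]] .
  have [measurable]: "(\<lambda>s. mirror_move N x (shd s))
      \<in> measurable (stream_space (coin_measure p)) (count_space UNIV)"
    by (rule measurable_compose[OF measurable_shd]) (simp add: coin_measure_def)
  show ?case
    by simp
qed

lemma coin_measure_move:
  assumes "0 < p" "p < 1"
  shows "(\<integral>\<^sup>+t. ennreal (of_bool (y = mirror_move N x t)) \<partial>coin_measure p)
         = ennreal (mirror_kernel N p x y)"
proof -
  let ?D = "pair_pmf (bernoulli_pmf p) (bernoulli_pmf (1 / 2))"
  let ?f = "\<lambda>t. of_bool (y = mirror_move N x t) :: real"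
  have "(\<integral>t. ?f t \<partial>measure_pmf ?D)
      = (\<Sum>t\<in>{(True, True), (True, False), (False, True), (False, False)}. ?f t * pmf ?D t)"
    by (rule integral_measure_pmf_real) auto
  also have "\<dots> = mirror_kernel N p x y"
    using assms by (simp add: pmf_pair mirror_move_def mirror_kernel_def of_bool_def field_simps)
  finally have "(\<integral>t. ?f t \<partial>measure_pmf ?D) = mirror_kernel N p x y" .
  moreover have "(\<integral>\<^sup>+t. ennreal (?f t) \<partial>measure_pmf ?D) = ennreal (\<integral>t. ?f t \<partial>measure_pmf ?D)"
    by (intro nn_integral_eq_integral measure_pmf.integrable_const_bound[where B = 1]) auto
  ultimately show ?thesis
    by (simp add: coin_measure_def)
qed

lemma mirror_kernel_nonneg: "0 < p \<Longrightarrow> p < 1 \<Longrightarrow> 0 \<le> mirror_kernel N p x y"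
  by (simp add: mirror_kernel_def)

lemma coin_walk_path:
  assumes p: "0 < p" "p < 1"
  shows "\<P>(s in stream_space (coin_measure p). \<forall>i\<le>n. coin_walk N i x s = xs i)
         = of_bool (xs 0 = x) * (\<Prod>i<n. mirror_kernel N p (xs i) (xs (Suc i)))"
proof (induction n arbitrary: x xs)
  interpret C: prob_space "coin_measure p"
    unfolding coin_measure_def by (rule measure_pmf.prob_space_axioms)
  interpret S: prob_space "stream_space (coin_measure p)"
    by (rule C.prob_space_stream_space)
  {
    case 0
    then show ?case by (auto simp: S.prob_space)
  next
    case (Suc n)
    let ?S = "stream_space (coin_measure p)"
    let ?c = "\<Prod>i<n. mirror_kernel N p (xs (Suc i)) (xs (Suc (Suc i)))"
    have c: "0 \<le> ?c"
      using p by (intro prod_nonneg) (simp add: mirror_kernel_nonneg)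
    have all_Suc: "(\<forall>i\<le>Suc n. Q i) \<longleftrightarrow> Q 0 \<and> (\<forall>i\<le>n. Q (Suc i))" for Q
      by (metis Suc_le_mono le0 not0_implies_Suc)
    have step: "\<P>(s in ?S. \<forall>i\<le>Suc n. coin_walk N i x (t ## s) = xs i)
        = of_bool (xs 0 = x) * (of_bool (xs 1 = mirror_move N x t) * ?c)" for t
      using Suc[of "mirror_move N x t" "\<lambda>i. xs (Suc i)"]
      by (cases "xs 0 = x") (auto simp: all_Suc)
    have "ennreal (\<P>(s in ?S. \<forall>i\<le>Suc n. coin_walk N i x s = xs i))
        = (\<integral>\<^sup>+t. \<P>(s in ?S. \<forall>i\<le>Suc n. coin_walk N i x (t ## s) = xs i) \<partial>coin_measure p)"
      by (rule C.prob_stream_space) measurable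
    also have "\<dots> = (\<integral>\<^sup>+t. ennreal (of_bool (xs 0 = x) * ?c)
                         * ennreal (of_bool (xs 1 = mirror_move N x t)) \<partial>coin_measure p)"
      unfolding step using c by (intro nn_integral_cong) (auto simp: of_bool_def)
    also have "\<dots> = ennreal (of_bool (xs 0 = x) * ?c) * ennreal (mirror_kernel N p x (xs 1))"
      by (subst nn_integral_cmult) (simp_all add: coin_measure_move[OF p], simp add: coin_measure_def)
    also have "\<dots> = ennreal (of_bool (xs 0 = x) * ?c * mirror_kernel N p x (xs 1))"
      using c by (simp add: ennreal_mult mirror_kernel_nonneg[OF p])
    finally have "\<P>(s in ?S. \<forall>i\<le>Suc n. coin_walk N i x s = xs i)
        = of_bool (xs 0 = x) * ?c * mirror_kernel N p x (xs 1)"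
      using c by (subst (asm) ennreal_inj) (simp_all add: mirror_kernel_nonneg[OF p])
    then show ?case
      unfolding prod.lessThan_Suc_shift by (auto simp: mult_ac)
  }
qed

lemma mirror_walk_coin_walk:
  assumes p: "0 < p" "p < 1"
  shows "mirror_walk (stream_space (coin_measure p)) N p x (\<lambda>n. coin_walk N n x)"
  unfolding mirror_walk_def
proof (intro conjI allI)
  interpret C: prob_space "coin_measure p"
    unfolding coin_measure_def by (rule measure_pmf.prob_space_axioms)
  show "prob_space (stream_space (coin_measure p))"
    by (rule C.prob_space_stream_space)
  fix n :: nat and xs :: "nat \<Rightarrow> nat" and y :: nat
  let ?ys = "xs(Suc n := y)"
  have "((\<forall>i\<le>n. coin_walk N i x s = xs i) \<and> coin_walk N (Suc n) x s = y)
      \<longleftrightarrow> (\<forall>i\<le>Suc n. coin_walk N i x s = ?ys i)" for s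
    by (auto simp: le_Suc_eq simp del: coin_walk.simps)
  moreover have "(\<Prod>i<n. mirror_kernel N p (?ys i) (?ys (Suc i)))
      = (\<Prod>i<n. mirror_kernel N p (xs i) (xs (Suc i)))"
    by (rule prod.cong) auto
  ultimately show "\<P>(s in stream_space (coin_measure p).
        (\<forall>i\<le>n. coin_walk N i x s = xs i) \<and> coin_walk N (Suc n) x s = y)
      = \<P>(s in stream_space (coin_measure p). \<forall>i\<le>n. coin_walk N i x s = xs i)
        * mirror_kernel N p (xs n) y"
    by (simp only: coin_walk_path[OF p] prod.lessThan_Suc) simp
qed (use measurable_coin_walk in auto)

end

theory Submission
  imports Defs
begin

text \<open>
  The mirror step preserves \<open>G x = x (N - x) / (1 - p)\<close>, while a symmetric unit step lowers its mean
  by \<open>1 / (1 - p)\<close>; hence the mean of \<open>G\<close> along the walk drops at each step by exactly the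
  probability \<open>P n\<close> that the particle is still in the interior. Summing, the \<open>P n\<close> have bounded
  partial sums, so they tend to \<open>0\<close>; as \<open>G\<close> vanishes on the boundary, its mean then tends to \<open>0\<close> too,
  and the expected number of steps, which is the sum of the \<open>P n\<close>, equals \<open>G x\<close>. Uniqueness of
  the solution of the linear system is a maximum principle.
\<close>

section \<open>The closed form as a solution of the linear system\<close>

definition mirror_time :: "nat \<Rightarrow> real \<Rightarrow> nat \<Rightarrow> real" where
  "mirror_time N p x = 1 / (1 - p) * real x * (real N - real x)"

lemma mirror_time_boundary [simp]: "mirror_time N p 0 = 0" "mirror_time N p N = 0"
  by (simp_all add: mirror_time_def)

lemma mirror_time_nonneg: "p < 1 \<Longrightarrow> x \<le> N \<Longrightarrow> 0 \<le> mirror_time N p x"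
  by (simp add: mirror_time_def)

lemma mirror_equations_mirror_time:
  assumes "p < 1"
  shows "mirror_equations N p (mirror_time N p)"
  unfolding mirror_equations_def
proof (intro conjI allI impI)
  fix x assume x: "0 < x \<and> x < N"
  have eq: "(1 - p) * mirror_time N p y = real y * (real N - real y)" for y
    using assms by (simp add: mirror_time_def)
  \<comment> \<open>Multiplying by \<open>1 - p\<close> clears the denominator and leaves the second
    difference identity (x-1)(N-x+1) + (x+1)(N-x-1) = 2x(N-x) - 2.\<close>
  have "(1 - p) * mirror_time N p (x - 1) + (1 - p) * mirror_time N p (x + 1)
      = 2 * ((1 - p) * mirror_time N p x) - 2"
    unfolding eq using x by (simp add: of_nat_diff algebra_simps)
  moreover have "mirror_time N p (N - x) = mirror_time N p x"
    using x by (simp add: mirror_time_def of_nat_diff)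
  ultimately show "mirror_time N p x = (1 - p) / 2 * mirror_time N p (x - 1)
      + (1 - p) / 2 * mirror_time N p (x + 1) + p * mirror_time N p (N - x) + 1"
    by (simp add: field_simps)
qed simp_all

section \<open>Maximum principle and uniqueness\<close>

lemma mirror_harmonic_le_0:
  fixes h :: "nat \<Rightarrow> real"
  assumes p: "0 < p" "p < 1"
    and h: "\<And>x. 0 < x \<Longrightarrow> x < N \<Longrightarrow>
      h x = (1 - p) / 2 * h (x - 1) + (1 - p) / 2 * h (x + 1) + p * h (N - x)"
    and bd: "h 0 = 0" "h N = 0"
    and x: "x \<le> N"
  shows "h x \<le> 0"
proof -
  define m where "m = Max (h ` {..N})"
  have m: "h y \<le> m" if "y \<le> N" for y
    using that by (simp add: m_def)
  have "m \<in> h ` {..N}"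
    unfolding m_def by (rule Max_in) auto
  then have ex: "\<exists>y. y \<le> N \<and> h y = m"
    by auto
  \<comment> \<open>At an interior maximum all three neighbours are maxima, so the leftmost one is on the boundary.\<close>
  define y where "y = (LEAST y. y \<le> N \<and> h y = m)"
  have y: "y \<le> N" "h y = m"
    using LeastI_ex[OF ex] by (simp_all add: y_def)
  have least: "h z \<noteq> m" if "z < y" for z
    using that y(1) not_less_Least[of z "\<lambda>y. y \<le> N \<and> h y = m"] by (auto simp: y_def)
  have "y = 0 \<or> y = N"
  proof (rule ccontr)
    assume "\<not> (y = 0 \<or> y = N)"
    with y have yi: "0 < y" "y < N"
      by auto
    have "h (y - 1) < m"
      using m[of "y - 1"] least[of "y - 1"] yi by fastforce
    \<comment> \<open>Since \<open>p < 1\<close>, the left neighbour has positive weight, so its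
      strict deficit survives the averaging; the other two need only weak bounds, and the three
      weights add up to 1.\<close>
    then have "(1 - p) / 2 * h (y - 1) < (1 - p) / 2 * m"
      using p by (intro mult_strict_left_mono) auto
    moreover have "(1 - p) / 2 * h (y + 1) \<le> (1 - p) / 2 * m" "p * h (N - y) \<le> p * m"
      using p yi by (auto intro!: mult_left_mono m)
    ultimately have "h y < (1 - p) / 2 * m + (1 - p) / 2 * m + p * m"
      using h[OF yi] by linarith
    then show False
      using y(2) by (simp add: field_simps)
  qed
  then have "m = 0"
    using y(2) bd by auto
  then show ?thesis
    using m[OF x] by simp
qed

text \<open>The constant 1 cancels in a difference of two solutions, leaving the homogeneous system.
  The one-sided bound is applied to the difference in both orders.\<close>

lemma mirror_equations_unique:
  assumes p: "0 < p" "p < 1" and f: "mirror_equations N p f" and g: "mirror_equations N p g"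
    and x: "x \<le> N"
  shows "f x = g x"
proof -
  have "a x - b x \<le> 0" if a: "mirror_equations N p a" and b: "mirror_equations N p b" for a b
  proof (rule mirror_harmonic_le_0[OF p _ _ _ x, where h = "\<lambda>x. a x - b x"])
    fix y assume "0 < y" "y < N"
    then have
      "a y = (1 - p) / 2 * a (y - 1) + (1 - p) / 2 * a (y + 1) + p * a (N - y) + 1"
      "b y = (1 - p) / 2 * b (y - 1) + (1 - p) / 2 * b (y + 1) + p * b (N - y) + 1"
      using a b unfolding mirror_equations_def by blast+
    then show "a y - b y = (1 - p) / 2 * (a (y - 1) - b (y - 1))
        + (1 - p) / 2 * (a (y + 1) - b (y + 1)) + p * (a (N - y) - b (N - y))"
      unfolding right_diff_distrib by linarith
  qed (use a b in \<open>simp_all add: mirror_equations_def\<close>)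
  from this[OF f g] this[OF g f] show ?thesis
    by simp
qed

section \<open>Kernel averages and total probability\<close>

lemma sum_mirror_kernel:
  assumes "a \<le> N"
  shows "(\<Sum>y\<le>N. mirror_kernel N p a y * f y) =
    (if 0 < a \<and> a < N then (1 - p) / 2 * f (a - 1) + (1 - p) / 2 * f (a + 1) + p * f (N - a)
     else f a)"
proof -
  \<comment> \<open>Each indicator of the kernel is summed separately, so coinciding targets need no
    case distinction. From a point of \<open>{..N}\<close> every target lies in
    \<open>{..N}\<close>, so the finite sum loses no mass.\<close>
  have delta: "(\<Sum>y\<le>N. c * of_bool (y = b) * f y) = c * f b" if "b \<le> N" for b c
    using that
    by (simp add: of_bool_def if_distrib[of "\<lambda>c. _ * c"] if_distrib[of "\<lambda>c. c * _"] cong: if_cong)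
  show ?thesis
  proof (cases "0 < a \<and> a < N")
    case True
    then have "a - 1 \<le> N" "a + 1 \<le> N" "N - a \<le> N"
      by auto
    with True show ?thesis
      by (simp only: mirror_kernel_def if_True simp_thms distrib_right sum.distrib delta)
  next
    case False
    then have "(\<Sum>y\<le>N. mirror_kernel N p a y * f y) = (\<Sum>y\<le>N. 1 * of_bool (y = a) * f y)"
      by (simp only: mirror_kernel_def if_False mult_1)
    then show ?thesis
      using False delta[OF assms, of 1] by (simp only: if_False mult_1)
  qed
qed

lemma mirror_kernel_outside: "a \<le> N \<Longrightarrow> N < y \<Longrightarrow> mirror_kernel N p a y = 0"
  by (auto simp: mirror_kernel_def)

text \<open>Total probability, used to sum out one coordinate of the walk. The series is infinite
  because the walk is only known to be \<open>nat\<close>-valued at first.\<close>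

lemma (in prob_space) prob_sums_nat_valued:
  fixes Y :: "'a \<Rightarrow> nat"
  assumes [measurable]: "Y \<in> measurable M (count_space UNIV)" "Measurable.pred M Q"
  shows "(\<lambda>v. \<P>(\<omega> in M. Y \<omega> = v \<and> Q \<omega>)) sums \<P>(\<omega> in M. Q \<omega>)"
proof -
  have "(\<lambda>v. \<P>(\<omega> in M. Y \<omega> = v \<and> Q \<omega>)) sums prob (\<Union>v. {\<omega>\<in>space M. Y \<omega> = v \<and> Q \<omega>})"
    by (rule finite_measure_UNION) (auto simp: disjoint_family_on_def)
  also have "(\<Union>v. {\<omega>\<in>space M. Y \<omega> = v \<and> Q \<omega>}) = {\<omega>\<in>space M. Q \<omega>}"
    by auto
  finally show ?thesis .
qed

section \<open>One-dimensional laws of the chain\<close>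

locale mirror_chain = prob_space M for M :: "'a measure" +
  fixes N :: nat and p :: real and x :: nat and X :: "nat \<Rightarrow> 'a \<Rightarrow> nat"
  assumes walk: "mirror_walk M N p x X" and x: "x \<le> N"
begin

lemma measurable_mirror_walk [measurable]: "X n \<in> measurable M (count_space UNIV)"
  using walk by (simp add: mirror_walk_def)

text \<open>\<open>mirror_walk\<close> prescribes transitions only after a complete path from time
  0. Induction on \<open>k\<close> forgets the earliest coordinate by summing over its value;
  \<open>k = n\<close> then gives the one-step Markov property.\<close>

lemma mirror_walk_transition_from:
  assumes "k \<le> n"
  shows "\<P>(\<omega> in M. (\<forall>i\<in>{k..n}. X i \<omega> = xs i) \<and> X (Suc n) \<omega> = y)
    = \<P>(\<omega> in M. \<forall>i\<in>{k..n}. X i \<omega> = xs i) * mirror_kernel N p (xs n) y"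
  using assms
proof (induction k arbitrary: xs)
  case 0
  have "\<P>(\<omega> in M. (\<forall>i\<le>n. X i \<omega> = xs i) \<and> X (Suc n) \<omega> = y)
    = \<P>(\<omega> in M. \<forall>i\<le>n. X i \<omega> = xs i) * mirror_kernel N p (xs n) y"
    using walk unfolding mirror_walk_def by blast
  then show ?case
    by (simp add: Ball_def)
next
  case (Suc k)
  have split: "(X k \<omega> = v \<and> (\<forall>i\<in>{Suc k..n}. X i \<omega> = xs i))
      \<longleftrightarrow> (\<forall>i\<in>{k..n}. X i \<omega> = (xs(k := v)) i)" for v \<omega>
  proof -
    have "{k..n} = insert k {Suc k..n}"
      using Suc.prems by auto
    then show ?thesis
      by auto
  qed
  \<comment> \<open>As \<open>k < n\<close>, updating \<open>xs\<close> at \<open>k\<close> leaves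
    \<open>xs n\<close> alone, so the kernel factor is independent of \<open>v\<close> and can be
    pulled out of the series.\<close>
  have IH: "\<P>(\<omega> in M. X k \<omega> = v \<and> (\<forall>i\<in>{Suc k..n}. X i \<omega> = xs i) \<and> X (Suc n) \<omega> = y)
      = \<P>(\<omega> in M. X k \<omega> = v \<and> (\<forall>i\<in>{Suc k..n}. X i \<omega> = xs i)) * mirror_kernel N p (xs n) y"
    for v
    using Suc.IH[of "xs(k := v)"] Suc.prems unfolding conj_assoc[symmetric] split by simp
  have "(\<lambda>v. \<P>(\<omega> in M. X k \<omega> = v \<and> (\<forall>i\<in>{Suc k..n}. X i \<omega> = xs i) \<and> X (Suc n) \<omega> = y))
      sums \<P>(\<omega> in M. (\<forall>i\<in>{Suc k..n}. X i \<omega> = xs i) \<and> X (Suc n) \<omega> = y)"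
    by (rule prob_sums_nat_valued) measurable
  note total = this[unfolded IH]
  have "(\<lambda>v. \<P>(\<omega> in M. X k \<omega> = v \<and> (\<forall>i\<in>{Suc k..n}. X i \<omega> = xs i)))
      sums \<P>(\<omega> in M. \<forall>i\<in>{Suc k..n}. X i \<omega> = xs i)"
    by (rule prob_sums_nat_valued) measurable
  from sums_unique2[OF total sums_mult2[OF this]] show ?case .
qed

lemma mirror_walk_transition:
  "\<P>(\<omega> in M. X n \<omega> = a \<and> X (Suc n) \<omega> = y) = \<P>(\<omega> in M. X n \<omega> = a) * mirror_kernel N p a y"
  using mirror_walk_transition_from[of n n "\<lambda>_. a" y] by simp

lemma mirror_walk_start: "\<P>(\<omega> in M. X 0 \<omega> = a) = of_bool (a = x)"
proof -
  have "AE \<omega> in M. X 0 \<omega> = x"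
    using walk by (simp add: mirror_walk_def)
  then have "\<P>(\<omega> in M. X 0 \<omega> = a) = \<P>(\<omega> in M. a = x)"
    by (intro prob_eq_AE) auto
  then show ?thesis
    by (simp add: prob_space)
qed

lemma mirror_walk_Suc_sums:
  "(\<lambda>a. \<P>(\<omega> in M. X n \<omega> = a) * mirror_kernel N p a y) sums \<P>(\<omega> in M. X (Suc n) \<omega> = y)"
  using prob_sums_nat_valued[of "X n" "\<lambda>\<omega>. X (Suc n) \<omega> = y"]
  by (simp add: mirror_walk_transition)

text \<open>The start lies in \<open>{..N}\<close> and the kernel never leaves this set. This turns
  the series over previous positions into finite sums.\<close>

lemma mirror_walk_outside:
  assumes "N < y"
  shows "\<P>(\<omega> in M. X n \<omega> = y) = 0"
  using assms
proof (induction n arbitrary: y)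
  case 0
  then show ?case
    using x by (simp add: mirror_walk_start)
next
  case (Suc n)
  have zero: "\<P>(\<omega> in M. X n \<omega> = a) * mirror_kernel N p a y = 0" for a
    using Suc.IH[of a] mirror_kernel_outside[of a N y p] Suc.prems by (cases "a \<le> N") auto
  have "(\<lambda>a. \<P>(\<omega> in M. X n \<omega> = a) * mirror_kernel N p a y) sums 0"
    unfolding zero by (rule sums_zero)
  then show ?case
    by (rule sums_unique2[OF mirror_walk_Suc_sums])
qed

lemma mirror_walk_Suc:
  "\<P>(\<omega> in M. X (Suc n) \<omega> = y) = (\<Sum>a\<le>N. \<P>(\<omega> in M. X n \<omega> = a) * mirror_kernel N p a y)"
proof (rule sums_unique2[OF mirror_walk_Suc_sums])
  show "(\<lambda>a. \<P>(\<omega> in M. X n \<omega> = a) * mirror_kernel N p a y) sums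
    (\<Sum>a\<le>N. \<P>(\<omega> in M. X n \<omega> = a) * mirror_kernel N p a y)"
    by (rule sums_finite) (auto simp: mirror_walk_outside)
qed

text \<open>The event on the left also admits positions above \<open>N\<close>, but these have
  probability 0.\<close>

lemma mirror_walk_interior:
  "\<P>(\<omega> in M. X n \<omega> \<noteq> 0 \<and> X n \<omega> \<noteq> N) = (\<Sum>a\<in>{0<..<N}. \<P>(\<omega> in M. X n \<omega> = a))"
proof (rule sums_unique2)
  show "(\<lambda>a. \<P>(\<omega> in M. X n \<omega> = a \<and> X n \<omega> \<noteq> 0 \<and> X n \<omega> \<noteq> N))
      sums \<P>(\<omega> in M. X n \<omega> \<noteq> 0 \<and> X n \<omega> \<noteq> N)"
    by (rule prob_sums_nat_valued) measurable
  have eq: "\<P>(\<omega> in M. X n \<omega> = a \<and> X n \<omega> \<noteq> 0 \<and> X n \<omega> \<noteq> N)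
      = (if a \<in> {0<..<N} then \<P>(\<omega> in M. X n \<omega> = a) else 0)" for a
  proof (cases "a = 0 \<or> a = N")
    case True
    then have "{\<omega>\<in>space M. X n \<omega> = a \<and> X n \<omega> \<noteq> 0 \<and> X n \<omega> \<noteq> N} = {}"
      by auto
    then show ?thesis
      using True by (simp only: measure_empty) auto
  next
    case False
    then have "{\<omega>\<in>space M. X n \<omega> = a \<and> X n \<omega> \<noteq> 0 \<and> X n \<omega> \<noteq> N} = {\<omega>\<in>space M. X n \<omega> = a}"
      by auto
    then show ?thesis
      using False mirror_walk_outside[of a n] by (cases "a < N") (simp_all only: , auto)
  qed
  show "(\<lambda>a. \<P>(\<omega> in M. X n \<omega> = a \<and> X n \<omega> \<noteq> 0 \<and> X n \<omega> \<noteq> N))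
      sums (\<Sum>a\<in>{0<..<N}. \<P>(\<omega> in M. X n \<omega> = a))"
    unfolding eq by (rule sums_If_finite_set) simp
qed

section \<open>The mean of a solution along the walk\<close>

lemma mirror_walk_mean_step:
  assumes "mirror_equations N p g"
  shows "(\<Sum>a\<le>N. \<P>(\<omega> in M. X (Suc n) \<omega> = a) * g a)
    = (\<Sum>a\<le>N. \<P>(\<omega> in M. X n \<omega> = a) * g a) - \<P>(\<omega> in M. X n \<omega> \<noteq> 0 \<and> X n \<omega> \<noteq> N)"
proof -
  \<comment> \<open>The equation for \<open>g\<close> says that averaging over one step costs
    exactly 1 in the interior; on the boundary the kernel is the identity and nothing is
    lost.\<close>
  have K: "(\<Sum>y\<le>N. mirror_kernel N p a y * g y) = g a - of_bool (a \<in> {0<..<N})" if "a \<le> N" for a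
  proof (cases "0 < a \<and> a < N")
    case True
    then have "g a = (1 - p) / 2 * g (a - 1) + (1 - p) / 2 * g (a + 1) + p * g (N - a) + 1"
      using assms unfolding mirror_equations_def by blast
    with True show ?thesis
      unfolding sum_mirror_kernel[OF that] by simp
  next
    case False
    then show ?thesis
      unfolding sum_mirror_kernel[OF that] by auto
  qed
  have "(\<Sum>y\<le>N. \<P>(\<omega> in M. X (Suc n) \<omega> = y) * g y)
      = (\<Sum>y\<le>N. \<Sum>a\<le>N. \<P>(\<omega> in M. X n \<omega> = a) * (mirror_kernel N p a y * g y))"
    by (simp add: mirror_walk_Suc sum_distrib_right mult.assoc)
  also have "\<dots> = (\<Sum>a\<le>N. \<P>(\<omega> in M. X n \<omega> = a) * (\<Sum>y\<le>N. mirror_kernel N p a y * g y))"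
    by (subst sum.swap) (simp add: sum_distrib_left)
  also have "\<dots> = (\<Sum>a\<le>N. \<P>(\<omega> in M. X n \<omega> = a) * g a)
      - (\<Sum>a\<le>N. \<P>(\<omega> in M. X n \<omega> = a) * of_bool (a \<in> {0<..<N}))"
    by (simp add: K right_diff_distrib sum_subtractf)
  also have "(\<Sum>a\<le>N. \<P>(\<omega> in M. X n \<omega> = a) * of_bool (a \<in> {0<..<N}))
      = (\<Sum>a\<in>{0<..<N}. \<P>(\<omega> in M. X n \<omega> = a))"
    by (rule sum.mono_neutral_cong_right) auto
  finally show ?thesis
    by (simp only: mirror_walk_interior)
qed

lemma mirror_walk_interior_sums:
  assumes g: "mirror_equations N p g" and nonneg: "\<And>a. a \<le> N \<Longrightarrow> 0 \<le> g a"
  shows "(\<lambda>n. \<P>(\<omega> in M. X n \<omega> \<noteq> 0 \<and> X n \<omega> \<noteq> N)) sums g x"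
proof -
  define P where "P n = \<P>(\<omega> in M. X n \<omega> \<noteq> 0 \<and> X n \<omega> \<noteq> N)" for n
  define E where "E n = (\<Sum>a\<le>N. \<P>(\<omega> in M. X n \<omega> = a) * g a)" for n
  have E_nonneg: "0 \<le> E n" for n
    unfolding E_def using nonneg by (intro sum_nonneg mult_nonneg_nonneg) auto
  have "E 0 = g x"
    using x
    by (simp add: E_def mirror_walk_start of_bool_def if_distrib[of "\<lambda>c. c * _"] cong: if_cong)
  \<comment> \<open>Telescoping of the one-step drops, starting from
    \<open>E 0 = g x\<close>.\<close>
  then have partial: "(\<Sum>k<n. P k) = g x - E n" for n
    by (induction n) (simp_all add: P_def E_def mirror_walk_mean_step[OF g])
  have "summable P"
  proof (rule summableI_nonneg_bounded)
    show "0 \<le> P n" for n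
      by (simp add: P_def)
    show "(\<Sum>k<n. P k) \<le> g x" for n
      using E_nonneg[of n] by (simp add: partial)
  qed
  then have "P \<longlonglongrightarrow> 0"
    by (rule summable_LIMSEQ_zero)
  define C where "C = (\<Sum>a\<le>N. g a)"
  \<comment> \<open>Only interior points contribute to \<open>E n\<close>, since \<open>g\<close>
    vanishes at 0 and \<open>N\<close>. The total \<open>C\<close> bounds every \<open>g a\<close>
    because all summands are nonnegative.\<close>
  have E_le: "E n \<le> C * P n" for n
  proof -
    have "E n = (\<Sum>a\<in>{0<..<N}. \<P>(\<omega> in M. X n \<omega> = a) * g a)"
      unfolding E_def
    proof (rule sum.mono_neutral_right)
      have "a = 0 \<or> a = N" if "a \<in> {..N} - {0<..<N}" for a
        using that by auto
      then show "\<forall>a\<in>{..N} - {0<..<N}. \<P>(\<omega> in M. X n \<omega> = a) * g a = 0"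
        using g by (auto simp: mirror_equations_def)
    qed auto
    also have "\<dots> \<le> (\<Sum>a\<in>{0<..<N}. \<P>(\<omega> in M. X n \<omega> = a) * C)"
      unfolding C_def using nonneg by (intro sum_mono mult_left_mono member_le_sum) auto
    also have "\<dots> = C * P n"
      by (simp only: P_def mirror_walk_interior sum_distrib_left mult.commute)
    finally show ?thesis .
  qed
  have "(\<lambda>n. C * P n) \<longlonglongrightarrow> 0"
    using tendsto_mult_right_zero[OF \<open>P \<longlonglongrightarrow> 0\<close>] .
  then have "E \<longlonglongrightarrow> 0"
    by (rule tendsto_sandwich[OF _ _ tendsto_const, rotated 2]) (auto simp: E_nonneg E_le)
  then have "(\<lambda>n. g x - E n) \<longlonglongrightarrow> g x - 0"
    by (intro tendsto_intros)
  then have "P sums g x"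
    by (simp add: sums_def partial)
  then show ?thesis
    by (simp add: P_def[abs_def])
qed

section \<open>Absorption and the expected hitting time\<close>

lemma mirror_walk_absorbed: "AE \<omega> in M. \<forall>n. X n \<omega> = 0 \<or> X n \<omega> = N \<longrightarrow> X (Suc n) \<omega> = X n \<omega>"
proof -
  \<comment> \<open>At a boundary point the kernel gives mass 1 to staying, so the event of being at
    \<open>a\<close> and its subset of staying there have equal probability; their difference is
    null.\<close>
  have stay: "AE \<omega> in M. X n \<omega> = a \<longrightarrow> X (Suc n) \<omega> = a" if "a = 0 \<or> a = N" for n a
  proof -
    have "\<P>(\<omega> in M. X n \<omega> = a \<and> X (Suc n) \<omega> = a) = \<P>(\<omega> in M. X n \<omega> = a)"
      using that by (auto simp: mirror_walk_transition mirror_kernel_def)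
    moreover have "\<P>(\<omega> in M. X n \<omega> = a \<and> X (Suc n) \<omega> \<noteq> a)
        = \<P>(\<omega> in M. X n \<omega> = a) - \<P>(\<omega> in M. X n \<omega> = a \<and> X (Suc n) \<omega> = a)"
      by (subst finite_measure_Diff[symmetric]) (auto intro!: arg_cong[where f = prob])
    ultimately have "\<P>(\<omega> in M. X n \<omega> = a \<and> X (Suc n) \<omega> \<noteq> a) = 0"
      by simp
    then show ?thesis
      by (subst (asm) prob_eq_0) (auto elim!: AE_mp)
  qed
  have "AE \<omega> in M. X n \<omega> = 0 \<or> X n \<omega> = N \<longrightarrow> X (Suc n) \<omega> = X n \<omega>" for n
    using stay[of 0 n] stay[of N n] by auto
  then show ?thesis
    by (simp add: AE_all_countable)
qed

text \<open>Strict inequality is the form required by the tail-sum formula. Paths that never hit the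
  boundary need no separate case: a lower bound on the infimum is a condition on each hitting time,
  vacuous if there are none.\<close>

lemma less_steps_to_boundary_iff:
  "enat n < steps_to_boundary N X \<omega> \<longleftrightarrow> (\<forall>m\<le>n. X m \<omega> \<noteq> 0 \<and> X m \<omega> \<noteq> N)"
proof -
  have "enat n < steps_to_boundary N X \<omega> \<longleftrightarrow> enat (Suc n) \<le> steps_to_boundary N X \<omega>"
    by (simp add: Suc_ile_eq)
  also have "\<dots> \<longleftrightarrow> (\<forall>m. X m \<omega> = 0 \<or> X m \<omega> = N \<longrightarrow> Suc n \<le> m)"
    by (auto simp: steps_to_boundary_def le_INF_iff)
  also have "\<dots> \<longleftrightarrow> (\<forall>m\<le>n. \<not> (X m \<omega> = 0 \<or> X m \<omega> = N))"
    by (metis not_less_eq_eq)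
  finally show ?thesis
    by (simp only: de_Morgan_disj)
qed

lemma measurable_steps_to_boundary [measurable]:
  "steps_to_boundary N X \<in> measurable M (count_space UNIV)"
proof -
  \<comment> \<open>The index set of the infimum depends on \<omega>. Rewriting it with
    \<open>LEAST\<close> reduces measurability to that of countably many predicates.\<close>
  have "steps_to_boundary N X \<omega> = (if \<exists>n. X n \<omega> = 0 \<or> X n \<omega> = N
      then enat (LEAST n. X n \<omega> = 0 \<or> X n \<omega> = N) else \<infinity>)" for \<omega>
  proof (cases "\<exists>n. X n \<omega> = 0 \<or> X n \<omega> = N")
    case True
    then have "X (LEAST n. X n \<omega> = 0 \<or> X n \<omega> = N) \<omega> = 0 \<or> X (LEAST n. X n \<omega> = 0 \<or> X n \<omega> = N) \<omega> = N"
      by (rule LeastI_ex)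
    then have "steps_to_boundary N X \<omega> = enat (LEAST n. X n \<omega> = 0 \<or> X n \<omega> = N)"
      unfolding steps_to_boundary_def
      by (intro antisym INF_lower INF_greatest) (auto intro: Least_le)
    with True show ?thesis
      by simp
  next
    case False
    then have "{n. X n \<omega> = 0 \<or> X n \<omega> = N} = {}"
      by auto
    with False show ?thesis
      by (simp only: steps_to_boundary_def) (simp add: top_enat_def)
  qed
  then have "steps_to_boundary N X = (\<lambda>\<omega>. if \<exists>n. X n \<omega> = 0 \<or> X n \<omega> = N
      then enat (LEAST n. X n \<omega> = 0 \<or> X n \<omega> = N) else \<infinity>)"
    by blast
  also have "\<dots> \<in> measurable M (count_space UNIV)"
    by measurable
  finally show ?thesis .
qed

text \<open>The expectation of an \<open>enat\<close>-valued time is the sum of its tail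
  probabilities. By absorption, not having hit the boundary up to time \<open>n\<close> agrees
  almost surely with being off it at time \<open>n\<close>, so the tails are the summands of
  \<open>mirror_walk_interior_sums\<close>.\<close>

lemma expected_steps_eq:
  assumes g: "mirror_equations N p g" and nonneg: "\<And>a. a \<le> N \<Longrightarrow> 0 \<le> g a"
  shows "expected_steps M N X = ennreal (g x)"
proof -
  have "emeasure M {\<omega>\<in>space M. enat n < steps_to_boundary N X \<omega>}
      = ennreal (\<P>(\<omega> in M. X n \<omega> \<noteq> 0 \<and> X n \<omega> \<noteq> N))" for n
    unfolding emeasure_eq_measure[symmetric]
  proof (rule emeasure_eq_AE)
    show "AE \<omega> in M. \<omega> \<in> {\<omega>\<in>space M. enat n < steps_to_boundary N X \<omega>}
        \<longleftrightarrow> \<omega> \<in> {\<omega>\<in>space M. X n \<omega> \<noteq> 0 \<and> X n \<omega> \<noteq> N}"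
      using mirror_walk_absorbed
    proof eventually_elim
      case (elim \<omega>)
      \<comment> \<open>A path on the boundary at time \<open>m\<close> is frozen from then on;
        hence a path off the boundary at time \<open>n\<close> never visited it before.\<close>
      have "X n \<omega> = X m \<omega>" if "m \<le> n" "X m \<omega> = 0 \<or> X m \<omega> = N" for m
        using that by (induction n rule: dec_induct) (use elim in auto)
      then have "(\<forall>m\<le>n. X m \<omega> \<noteq> 0 \<and> X m \<omega> \<noteq> N) \<longleftrightarrow> X n \<omega> \<noteq> 0 \<and> X n \<omega> \<noteq> N"
        by (metis order_refl)
      then show ?case
        by (simp add: less_steps_to_boundary_iff)
    qed
  qed measurable
  then have "expected_steps M N X = (\<Sum>n. ennreal (\<P>(\<omega> in M. X n \<omega> \<noteq> 0 \<and> X n \<omega> \<noteq> N)))"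
    unfolding expected_steps_def by (simp add: nn_integral_enat_function)
  also have "\<dots> = ennreal (g x)"
    by (rule suminf_ennreal_eq[OF _ mirror_walk_interior_sums[OF g nonneg]]) simp_all
  finally show ?thesis .
qed

end

theorem mainTheorem4:
  fixes N :: nat and p :: real and M :: "'a measure"
  assumes "N \<ge> 1" and "0 < p" and "p < 1"
  shows "(\<forall>x X. x \<le> N \<longrightarrow> mirror_walk M N p x X \<longrightarrow>
            expected_steps M N X = ennreal (1 / (1 - p) * real x * (real N - real x)))
       \<and> (\<forall>g. mirror_equations N p g \<longrightarrow>
            (\<forall>x\<le>N. g x = 1 / (1 - p) * real x * (real N - real x)))"
proof -
  note eqs = mirror_equations_mirror_time[OF \<open>p < 1\<close>, of N]
  have "expected_steps M N X = ennreal (mirror_time N p x)"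
    if "x \<le> N" "mirror_walk M N p x X" for x X
  proof -
    interpret mirror_chain M N p x X
      using that
      by (intro mirror_chain.intro mirror_chain_axioms.intro) (simp_all add: mirror_walk_def)
    show ?thesis
      using eqs mirror_time_nonneg[OF \<open>p < 1\<close>] by (rule expected_steps_eq)
  qed
  moreover have "g x = mirror_time N p x" if "mirror_equations N p g" "x \<le> N" for g x
    using mirror_equations_unique[OF assms(2,3) that(1) eqs that(2)] .
  ultimately show ?thesis
    by (simp add: mirror_time_def)
qed

end
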